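(* Let $\nu$ be a complex number that is not a negative integer, and let $D_{n,\nu}(q) = \prod_{k=1}^n [k+\nu]_q^{\lfloor n/k \rfloor}$. Then there exist polynomials $N_{n,\nu}(q)$, $n\ge1$, in $q$, $q^\nu$ and $[\nu]_q$ with nonnegative integer coefficients such that, as formal power series in $z$, both \[ \frac{J_{\nu+1}((1-q)z;q^{-1})}{J_\nu((1-q)z;q^{-1})} = - \sum_{n=1}^{\infty} \frac{N_{n,\nu}(q)}{D_{n,\nu}(q)} q^{(\nu+1)n} z^{2n-1} \] and \[ \frac{J_{\nu+1}((1-q)z;q)}{J_\nu((1-q)z;q)} = (1-q)z + \sum_{n\ge1}\frac{N_{n,\nu}(q)}{D_{n,\nu}(q)} q^{n+\nu} z^{2n-1} \] hold.
   Context: Notation: $(a;p)_n=(1-a)(1-ap)\cdots(1-ap^{n-1})$, $(a;p)_\infty=\prod_{i\ge0}(1-ap^i)$, and $[x]_q=(1-q^x)/(1-q)$. The Hahn–Exton $q$-Bessel function with base $p$ is $J_\nu(w;p)=\frac{(p^{\nu+1};p)_\infty w^\nu}{(p;p)_\infty}\Phi_\nu(w;p)$, where $\Phi_\nu(w;p)=\sum_{n\ge0}\frac{(-1)^n p^{\binom n2}(p w^2)^n}{(p;p)_n(p^{\nu+1};p)_n}$. Consequently $\frac{J_{\nu+1}(w;p)}{J_\nu(w;p)}=\frac{w}{1-p^{\nu+1}}\cdot\frac{\Phi_{\nu+1}(w;p)}{\Phi_\nu(w;p)}$; for base $p=q^{-1}$ the ratio is understood as this formal power series in $w$, whose coefficients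 are rational functions of $q$ and $q^\nu$. *)

theory Defs
  imports "HOL-Analysis.Analysis" "HOL-Library.Poly_Mapping"
begin

text \<open>
  A base \<open>p \<noteq> 0\<close> is represented by a logarithm \<open>t\<close>, i.e. \<open>p = exp t\<close>, which fixes the
  otherwise multivalued complex powers as \<open>p\<^sup>x = exp (t * x)\<close>.  The base \<open>p\<^sup>-\<^sup>1\<close>, with the
  compatible powers \<open>(p\<^sup>-\<^sup>1)\<^sup>x = p\<^sup>-\<^sup>x\<close>, is then represented by \<open>- t\<close>.
\<close>

definition bpow :: "complex \<Rightarrow> complex \<Rightarrow> complex" where
  "bpow t x = exp (t * x)"

definition qnum :: "complex \<Rightarrow> complex \<Rightarrow> complex" where
  "qnum t x = (1 - bpow t x) / (1 - exp t)"

definition qpoch :: "complex \<Rightarrow> complex \<Rightarrow> nat \<Rightarrow> complex" where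
  "qpoch a p n = (\<Prod>i<n. 1 - a * p ^ i)"

definition qpoch_inf :: "complex \<Rightarrow> complex \<Rightarrow> complex" where
  "qpoch_inf a p = prodinf (\<lambda>i. 1 - a * p ^ i)"

definition hahn_exton_coeff :: "complex \<Rightarrow> complex \<Rightarrow> nat \<Rightarrow> complex" where
  "hahn_exton_coeff \<nu> t n =
     (-1) ^ n * exp t ^ (n choose 2) * exp t ^ n /
     (qpoch (exp t) (exp t) n * qpoch (bpow t (\<nu> + 1)) (exp t) n)"

text \<open>The series \<open>\<Phi>\<^sub>\<nu>(w; p)\<close> as a formal power series in \<open>w\<close>.\<close>

definition hahn_exton_Phi :: "complex \<Rightarrow> complex \<Rightarrow> complex fps" where
  "hahn_exton_Phi \<nu> t = Abs_fps (hahn_exton_coeff \<nu> t) oo fps_X ^ 2"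

text \<open>
  The ratio \<open>J\<^sub>\<nu>\<^sub>+\<^sub>1(w; p) / J\<^sub>\<nu>(w; p)\<close> as a formal power series in \<open>w\<close>; it makes sense for
  bases inside and outside the unit disc.  That it is the expansion of the quotient of the
  actual functions \<open>J\<close> when \<open>|p| < 1\<close> is \<open>hahn_exton_J_ratio_expansion\<close> below.
\<close>

definition hahn_exton_ratio :: "complex \<Rightarrow> complex \<Rightarrow> complex fps" where
  "hahn_exton_ratio \<nu> t =
     fps_const (1 / (1 - bpow t (\<nu> + 1))) * fps_X *
     (hahn_exton_Phi (\<nu> + 1) t / hahn_exton_Phi \<nu> t)"

text \<open>The Hahn--Exton function itself; meaningful for \<open>|p| < 1\<close>, i.e. \<open>Re t < 0\<close>.\<close>

definition hahn_exton_J :: "complex \<Rightarrow> complex \<Rightarrow> complex \<Rightarrow> complex" where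
  "hahn_exton_J \<nu> t w =
     qpoch_inf (bpow t (\<nu> + 1)) (exp t) / qpoch_inf (exp t) (exp t) * w powr \<nu> *
     suminf (\<lambda>n. hahn_exton_coeff \<nu> t n * (w\<^sup>2) ^ n)"

definition Dprod :: "nat \<Rightarrow> complex \<Rightarrow> complex \<Rightarrow> complex" where
  "Dprod n \<nu> t = (\<Prod>k=1..n. qnum t (of_nat k + \<nu>) ^ (n div k))"

text \<open>
  Polynomials in three variables with nonnegative integer coefficients are finitely supported
  maps from exponent triples to \<open>nat\<close>; this is their evaluation at \<open>(x, y, u)\<close>.
\<close>

definition eval3 :: "(nat \<times> nat \<times> nat \<Rightarrow>\<^sub>0 nat) \<Rightarrow> complex \<Rightarrow> complex \<Rightarrow> complex \<Rightarrow> complex" where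
  "eval3 P x y u =
     (\<Sum>(i, j, k)\<in>Poly_Mapping.keys P.
        of_nat (Poly_Mapping.lookup P (i, j, k)) * x ^ i * y ^ j * u ^ k)"

text \<open>The formal power series \<open>\<Sum>n\<ge>1. c n * z^(2 * n - 1)\<close>; the value \<open>c 0\<close> is not used.\<close>

definition odd_fps :: "(nat \<Rightarrow> complex) \<Rightarrow> complex fps" where
  "odd_fps c = Abs_fps (\<lambda>m. if odd m then c ((m + 1) div 2) else 0)"

lemma hahn_exton_Phi_nth:
  "fps_nth (hahn_exton_Phi \<nu> t) m = (if even m then hahn_exton_coeff \<nu> t (m div 2) else 0)"
proof -
  have "fps_nth (hahn_exton_Phi \<nu> t) m
      = (\<Sum>i=0..m. hahn_exton_coeff \<nu> t i * (if m = 2 * i then 1 else 0))"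
    by (simp add: hahn_exton_Phi_def fps_compose_nth power_mult [symmetric] fps_X_power_nth)
  also have "\<dots> = (if even m then hahn_exton_coeff \<nu> t (m div 2) else 0)"
  proof (cases "even m")
    case True
    then obtain k where k: "m = 2 * k" by blast
    have "(\<Sum>i=0..m. hahn_exton_coeff \<nu> t i * (if m = 2 * i then 1 else 0))
        = (\<Sum>i=0..m. if i = k then hahn_exton_coeff \<nu> t i else 0)"
      by (intro sum.cong) (auto simp: k)
    then show ?thesis using k by simp
  next
    case False
    then show ?thesis by (auto intro!: sum.neutral)
  qed
  finally show ?thesis .
qed

lemma bpow_add_of_nat: "bpow t (x + of_nat k) = bpow t x * exp t ^ k"
  by (simp add: bpow_def distrib_left exp_add exp_of_nat_mult [symmetric] mult.commute)

lemma summable_hahn_exton: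
  assumes t: "Re t < 0"
  shows "summable (\<lambda>n. hahn_exton_coeff \<nu> t n * x ^ n)"
proof -
  define p where "p = exp t"
  define b where "b = bpow t (\<nu> + 1)"
  have p1: "norm p < 1" using t by (simp add: p_def)
  let ?r = "\<lambda>n. - (p ^ n * p * x) / ((1 - p ^ Suc n) * (1 - b * p ^ n))"
  have step: "hahn_exton_coeff \<nu> t (Suc n) * x ^ Suc n =
      ?r n * (hahn_exton_coeff \<nu> t n * x ^ n)" for n
  proof -
    have c: "Suc n choose 2 = n + (n choose 2)"
      by (simp add: numeral_2_eq_2)
    show ?thesis
      unfolding hahn_exton_coeff_def c p_def [symmetric] b_def [symmetric]
      by (simp add: qpoch_def power_add mult_ac)
  qed
  have P: "(\<lambda>n. p ^ n) \<longlonglongrightarrow> 0" using p1 by (rule LIMSEQ_power_zero)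
  have "?r \<longlonglongrightarrow> - (0 * p * x) / ((1 - 0) * (1 - b * 0))"
    by (intro tendsto_intros P LIMSEQ_Suc[OF P]) auto
  then have "?r \<longlonglongrightarrow> 0" by simp
  then have "(\<lambda>n. norm (?r n)) \<longlonglongrightarrow> 0" by (rule tendsto_norm_zero)
  then have "eventually (\<lambda>n. norm (?r n) < 1/2) sequentially"
    by (rule order_tendstoD) simp
  then obtain N where N: "\<And>n. n \<ge> N \<Longrightarrow> norm (?r n) < 1/2"
    by (auto simp: eventually_sequentially)
  show ?thesis
  proof (rule summable_ratio_test[of "1/2" N])
    fix n assume "N \<le> n"
    then show "norm (hahn_exton_coeff \<nu> t (Suc n) * x ^ Suc n)
        \<le> 1/2 * norm (hahn_exton_coeff \<nu> t n * x ^ n)"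
      unfolding step norm_mult[of "?r n"] by (rule mult_right_mono[OF less_imp_le[OF N]]) auto
  qed simp
qed

lemma hahn_exton_Phi_expansion:
  assumes t: "Re t < 0"
  shows "(\<lambda>w. suminf (\<lambda>n. hahn_exton_coeff \<nu> t n * (w\<^sup>2) ^ n))
    has_fps_expansion hahn_exton_Phi \<nu> t"
proof (rule has_fps_expansionI, rule always_eventually, rule allI)
  fix u :: complex
  have "(\<lambda>n. hahn_exton_coeff \<nu> t n * (u\<^sup>2) ^ n)
      sums suminf (\<lambda>n. hahn_exton_coeff \<nu> t n * (u\<^sup>2) ^ n)"
    using summable_hahn_exton[OF t] by (rule summable_sums)
  also have "(\<lambda>n. hahn_exton_coeff \<nu> t n * (u\<^sup>2) ^ n)
      = (\<lambda>n. fps_nth (hahn_exton_Phi \<nu> t) (2 * n) * u ^ (2 * n))"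
    by (simp add: hahn_exton_Phi_nth power_mult [symmetric])
  finally show "(\<lambda>n. fps_nth (hahn_exton_Phi \<nu> t) n * u ^ n)
      sums suminf (\<lambda>n. hahn_exton_coeff \<nu> t n * (u\<^sup>2) ^ n)"
    by (subst (asm) sums_mono_reindex)
       (auto simp: strict_mono_def hahn_exton_Phi_nth image_iff power_mult [symmetric] elim!: evenE)
qed

lemma convergent_qpoch:
  assumes "norm p < 1"
  shows "convergent_prod (\<lambda>i. 1 - a * p ^ i :: complex)"
proof -
  have "summable (\<lambda>i. norm (- (a * p ^ i)))"
    using assms by (simp add: norm_mult norm_power summable_mult)
  then have "abs_convergent_prod (\<lambda>i. 1 + (- (a * p ^ i)))"
    using summable_imp_abs_convergent_prod[of "\<lambda>i. 1 - a * p ^ i"] by simp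
  then show ?thesis by (simp add: abs_convergent_prod_imp_convergent_prod)
qed

lemma qpoch_inf_nonzero:
  assumes "norm p < 1" and "\<And>i. a * p ^ i \<noteq> 1"
  shows "qpoch_inf a p \<noteq> 0"
  unfolding qpoch_inf_def
  by (rule prodinf_nonzero) (use assms convergent_qpoch[OF assms(1)] in auto)

lemma qpoch_inf_shift:
  assumes "norm p < 1"
  shows "qpoch_inf a p = (1 - a) * qpoch_inf (a * p) p"
proof -
  let ?f = "\<lambda>i. 1 - a * p ^ i"
  have "(\<lambda>i. 1 - (a * p) * p ^ i) has_prod qpoch_inf (a * p) p"
    unfolding qpoch_inf_def by (intro convergent_prod_has_prod convergent_qpoch assms)
  then have "(\<lambda>i. ?f (Suc i)) has_prod qpoch_inf (a * p) p"
    by (simp add: mult_ac)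
  then have "?f has_prod (qpoch_inf (a * p) p * ?f 0)"
    by (rule has_prod_Suc_imp)
  then show ?thesis
    by (simp add: qpoch_inf_def has_prod_iff mult.commute)
qed

lemma hahn_exton_J_ratio_expansion:
  assumes t: "Re t < 0" and ne: "\<forall>k::nat. k \<ge> 1 \<longrightarrow> bpow t (\<nu> + of_nat k) \<noteq> 1"
  shows "(\<lambda>w. hahn_exton_J (\<nu> + 1) t w / hahn_exton_J \<nu> t w)
    has_fps_expansion hahn_exton_ratio \<nu> t"
proof -
  define p where "p = exp t"
  define b where "b = bpow t (\<nu> + 1)"
  have p1: "norm p < 1" using t by (simp add: p_def)
  have b2: "bpow t (\<nu> + 1 + 1) = b * p"
    using bpow_add_of_nat[of t "\<nu> + 1" 1] by (simp add: b_def p_def)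
  have bi: "b * p ^ i \<noteq> 1" for i
    using ne[rule_format, of "Suc i"] bpow_add_of_nat[of t "\<nu> + 1" i]
    by (simp add: b_def p_def add_ac)
  define f where "f = (\<lambda>\<nu> w. suminf (\<lambda>n. hahn_exton_coeff \<nu> t n * (w\<^sup>2) ^ n))"
  have F: "f \<nu> has_fps_expansion hahn_exton_Phi \<nu> t"
    unfolding f_def by (rule hahn_exton_Phi_expansion[OF t])
  have F1: "f (\<nu> + 1) has_fps_expansion hahn_exton_Phi (\<nu> + 1) t"
    unfolding f_def by (rule hahn_exton_Phi_expansion[OF t])
  have Phi0: "fps_nth (hahn_exton_Phi \<nu> t) 0 \<noteq> 0"
    by (simp add: hahn_exton_Phi_nth hahn_exton_coeff_def qpoch_def numeral_2_eq_2)
  have "(\<lambda>w. (1 / (1 - b)) * w * (f (\<nu> + 1) w / f \<nu> w)) has_fps_expansion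
      fps_const (1 / (1 - b)) * fps_X * (hahn_exton_Phi (\<nu> + 1) t / hahn_exton_Phi \<nu> t)"
    by (intro has_fps_expansion_mult has_fps_expansion_const has_fps_expansion_fps_X
          has_fps_expansion_divide' F F1 Phi0)
  moreover have "(\<lambda>w. hahn_exton_J (\<nu> + 1) t w / hahn_exton_J \<nu> t w)
      = (\<lambda>w. (1 / (1 - b)) * w * (f (\<nu> + 1) w / f \<nu> w))"
  proof
    fix w :: complex
    have pp: "p * p ^ i \<noteq> 1" for i
      using p1 by (metis norm_one norm_power power_Suc norm_ge_zero less_irrefl power_less_one_iff zero_less_Suc)
    have z1: "qpoch_inf p p \<noteq> 0" by (rule qpoch_inf_nonzero[OF p1 pp])
    have z2: "qpoch_inf (b * p) p \<noteq> 0"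
      using bi[of "Suc _"] by (intro qpoch_inf_nonzero[OF p1]) (simp add: mult_ac)
    have b1: "b \<noteq> 1" using bi[of 0] by simp
    have sh: "qpoch_inf b p = (1 - b) * qpoch_inf (b * p) p"
      by (rule qpoch_inf_shift[OF p1])
    show "hahn_exton_J (\<nu> + 1) t w / hahn_exton_J \<nu> t w
        = (1 / (1 - b)) * w * (f (\<nu> + 1) w / f \<nu> w)"
    proof (cases "w = 0")
      case True
      then show ?thesis by (simp add: hahn_exton_J_def)
    next
      case False
      have "w powr (\<nu> + 1) = w powr \<nu> * w" "w powr \<nu> \<noteq> 0"
        using False by (simp_all add: powr_add)
      then show ?thesis
        using z1 z2 b1
        unfolding hahn_exton_J_def b2 p_def [symmetric] b_def [symmetric] sh f_def
        by (simp add: divide_simps)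
    qed
  qed
  ultimately show ?thesis by (simp add: hahn_exton_ratio_def b_def)
qed

end

theory Submission
  imports Defs
begin

text \<open>
  Put \<open>b = q\<^bsup>\<nu>+1\<^esup>\<close>, \<open>A(x) = \<phi>(x; b)\<close> and \<open>B(x) = \<phi>(x; bq) / (1 - b)\<close>, where \<open>\<Phi>\<^sub>\<nu>(w; q) = \<phi>(w\<^sup>2; b)\<close>.
  Comparing coefficients gives \<open>B(x) - b B(qx) = A(x)\<close> and \<open>A(x/q) = A(x) - x B(x)\<close>.  Hence
  \<open>\<rho>(x) = B(x) / A(x/q)\<close> and the ratio \<open>r = B / A\<close> satisfy \<open>r(x) = 1 + b \<rho>(qx)\<close> and
  \<open>\<rho> = r (1 + x \<rho>)\<close>.  Inverting the base replaces \<open>A(x)\<close> by \<open>A(bx/q)\<close>, so the ratio for the base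
  \<open>q\<^sup>-\<^sup>1\<close> is \<open>- b \<rho>(bx)\<close>: both expansions have the coefficients of \<open>\<rho>\<close>.  Finally
  \<open>\<rho> = (1 + b \<rho>(qx)) (1 + x \<rho>)\<close> is a quadratic recurrence with nonnegative coefficients, and
  \<open>\<lfloor>n/m\<rfloor> \<ge> \<lfloor>k/m\<rfloor> + \<lfloor>(n-k)/m\<rfloor>\<close> shows that \<open>D\<^sub>n\<close> clears its denominators.
\<close>

section \<open>The series in x = w^2 and inversion of the base\<close>

definition phi :: "complex \<Rightarrow> complex \<Rightarrow> complex fps" where
  "phi \<nu> t = Abs_fps (hahn_exton_coeff \<nu> t)"

lemma phi_nth_0 [simp]: "fps_nth (phi \<nu> t) 0 = 1"
  by (simp add: phi_def hahn_exton_coeff_def qpoch_def numeral_2_eq_2)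

lemma bpow_add: "bpow t (x + y) = bpow t x * bpow t y"
  by (simp add: bpow_def distrib_left exp_add)

lemma bpow_1 [simp]: "bpow t 1 = exp t"
  by (simp add: bpow_def)

lemma bpow_minus: "bpow (- t) x = inverse (bpow t x)"
  by (simp add: bpow_def exp_minus)

lemma bpow_nonzero [simp]: "bpow t x \<noteq> 0"
  by (simp add: bpow_def)

lemma qpoch_Suc_left: "qpoch a p (Suc n) = (1 - a) * qpoch (a * p) p n"
  by (simp add: qpoch_def prod.lessThan_Suc_shift mult_ac del: prod.lessThan_Suc)

text \<open>Holds unconditionally because division by zero yields 0: where a new factor of the
  denominator vanishes, both sides are 0.\<close>

lemma hahn_exton_coeff_Suc:
  "hahn_exton_coeff \<nu> t (Suc n) =
     - (exp t ^ Suc n) / ((1 - exp t ^ Suc n) * (1 - bpow t (\<nu> + 1) * exp t ^ n)) *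
     hahn_exton_coeff \<nu> t n"
proof -
  have c: "Suc n choose 2 = n + (n choose 2)"
    by (simp add: numeral_2_eq_2)
  show ?thesis
    unfolding hahn_exton_coeff_def c by (simp add: qpoch_def power_add mult_ac)
qed

text \<open>In the term ratio, replacing q by 1/q inverts X = q^(n+1) and Y = q^(\<nu>+n+1).
  Clearing the inverses turns the numerator X into Y = q^\<nu> X, so every step contributes one
  factor q^\<nu>.\<close>

lemma hahn_exton_coeff_minus:
  "hahn_exton_coeff \<nu> (- t) n = bpow t \<nu> ^ n * hahn_exton_coeff \<nu> t n"
proof (induction n)
  case 0
  show ?case by (simp add: hahn_exton_coeff_def qpoch_def numeral_2_eq_2)
next
  case (Suc n)
  define q where "q = exp t"
  define a where "a = bpow t \<nu>"
  have nz: "q \<noteq> 0" "a \<noteq> 0" by (simp_all add: q_def a_def)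
  have aux: "- inverse X / ((1 - inverse X) * (1 - inverse Y)) = - Y / ((1 - X) * (1 - Y))"
    if "X \<noteq> 0" "Y \<noteq> 0" for X Y :: complex
  \<comment> \<open>At X = 1 or Y = 1 both denominators are 0, hence so are both quotients.\<close>
  proof (cases "X = 1 \<or> Y = 1")
    case False
    then show ?thesis using that by (auto simp: divide_simps) (simp add: algebra_simps)
  qed auto
  have "- (exp (- t) ^ Suc n) / ((1 - exp (- t) ^ Suc n) * (1 - bpow (- t) (\<nu> + 1) * exp (- t) ^ n))
      = - inverse (q ^ Suc n) / ((1 - inverse (q ^ Suc n)) * (1 - inverse (a * q * q ^ n)))"
    by (simp add: bpow_minus bpow_add exp_minus q_def a_def power_inverse)
  also have "\<dots> = - (a * q * q ^ n) / ((1 - q ^ Suc n) * (1 - a * q * q ^ n))"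
    by (rule aux) (use nz in auto)
  finally have *: "- (exp (- t) ^ Suc n) /
      ((1 - exp (- t) ^ Suc n) * (1 - bpow (- t) (\<nu> + 1) * exp (- t) ^ n)) = \<dots>" .
  show ?case
    unfolding hahn_exton_coeff_Suc[of \<nu> "- t" n] hahn_exton_coeff_Suc[of \<nu> t n] Suc.IH *
    by (simp add: bpow_add flip: q_def a_def)
qed

lemma phi_minus: "phi \<nu> (- t) = phi \<nu> t oo (fps_const (bpow t \<nu>) * fps_X)"
  by (simp add: fps_eq_iff phi_def hahn_exton_coeff_minus)

section \<open>The Bessel ratio as w times a series in w^2\<close>

definition phi_ratio :: "complex \<Rightarrow> complex \<Rightarrow> complex fps" where
  "phi_ratio \<nu> t = fps_const (1 / (1 - bpow t (\<nu> + 1))) * phi (\<nu> + 1) t / phi \<nu> t"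

lemma fps_const_mult_divide:
  fixes f g :: "complex fps"
  assumes "fps_nth g 0 \<noteq> 0"
  shows "fps_const c * f / g = fps_const c * (f / g)"
  using assms by (simp add: fps_divide_unit mult.assoc)

lemma hahn_exton_ratio_eq: "hahn_exton_ratio \<nu> t = fps_X * (phi_ratio \<nu> t oo fps_X ^ 2)"
  unfolding hahn_exton_ratio_def phi_ratio_def hahn_exton_Phi_def phi_def [symmetric]
  by (simp add: fps_const_mult_divide fps_compose_mult_distrib fps_divide_compose mult_ac)

text \<open>Here \<open>c\<close> will be 1 - q, from the substitution w = (1 - q) z.\<close>

lemma hahn_exton_ratio_nth:
  "fps_nth (hahn_exton_ratio \<nu> t oo (fps_const c * fps_X)) m =
     (if odd m then c ^ m * fps_nth (phi_ratio \<nu> t) (m div 2) else 0)"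
proof -
  have "fps_nth (phi_ratio \<nu> t oo fps_X ^ 2) m =
      (if even m then fps_nth (phi_ratio \<nu> t) (m div 2) else 0)" for m
  proof -
    have "fps_nth (phi_ratio \<nu> t oo fps_X ^ 2) m
        = (\<Sum>i=0..m. fps_nth (phi_ratio \<nu> t) i * (if m = 2 * i then 1 else 0))"
      by (simp add: fps_compose_nth power_mult [symmetric] fps_X_power_nth)
    also have "\<dots> = (\<Sum>i=0..m. if i = m div 2 then (if even m then fps_nth (phi_ratio \<nu> t) i else 0) else 0)"
      by (intro sum.cong) auto
    also have "\<dots> = (if even m then fps_nth (phi_ratio \<nu> t) (m div 2) else 0)"
      by (subst sum.delta) auto
    finally show ?thesis .
  qed
  then show ?thesis
    by (cases m) (auto simp: hahn_exton_ratio_eq elim!: oddE)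
qed

section \<open>The q-difference equations and the series \<open>rho\<close>\<close>

locale generic_base =
  fixes \<nu> t :: complex
  assumes exp_power_neq_1: "k \<ge> 1 \<Longrightarrow> exp t ^ k \<noteq> 1"
    and bpow_shift_neq_1: "k \<ge> 1 \<Longrightarrow> bpow t (\<nu> + of_nat k) \<noteq> 1"
begin

abbreviation "q \<equiv> exp t"
abbreviation "b \<equiv> bpow t (\<nu> + 1)"
abbreviation "A \<equiv> phi \<nu> t"

definition B :: "complex fps" where
  "B = fps_const (1 / (1 - b)) * phi (\<nu> + 1) t"

definition A_shift :: "complex fps" where
  "A_shift = A oo (fps_const (inverse q) * fps_X)"

definition rho :: "complex fps" where
  "rho = B / A_shift"

lemma b_power_neq_1: "b * q ^ n \<noteq> 1"
  using bpow_shift_neq_1[of "Suc n"] bpow_add_of_nat[of t "\<nu> + 1" n] by (simp add: add_ac)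

lemma b_neq_1: "b \<noteq> 1"
  using b_power_neq_1[of 0] by simp

lemma A_shift_nth_0 [simp]: "fps_nth A_shift 0 = 1"
  by (simp add: A_shift_def)

text \<open>Both (1 - b) (bq;q)_n and (b;q)_n (1 - b q^n) equal (b;q)_(n+1), split at its first or
  its last factor.\<close>

lemma B_nth: "(1 - b * q ^ n) * fps_nth B n = fps_nth A n"
proof -
  have b': "bpow t (\<nu> + 1 + 1) = b * q"
    by (simp only: bpow_add bpow_1)
  have qpoch: "(1 - b) * qpoch (b * q) q n = qpoch b q n * (1 - b * q ^ n)"
    unfolding qpoch_Suc_left[symmetric] by (simp add: qpoch_def)
  have cancel: "d * (x / (y * (z * d))) = x / (y * z)" if "d \<noteq> 0" for d x y z :: complex
    using that by simp
  have "fps_nth B n =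
      (- 1) ^ n * q ^ (n choose 2) * q ^ n / (qpoch q q n * ((1 - b) * qpoch (b * q) q n))"
    unfolding B_def phi_def hahn_exton_coeff_def b' by (simp add: mult_ac)
  then show ?thesis
    using b_power_neq_1[of n] unfolding qpoch
    by (simp add: phi_def hahn_exton_coeff_def cancel del: times_divide_eq_right)
qed

text \<open>The term ratio of \<open>A\<close> contains 1 / (1 - b q^n), which is exactly what turns
  the coefficient of \<open>A\<close> into that of \<open>B\<close>. This is A(x/q) = A(x) - x B(x)
  read off coefficientwise.\<close>

lemma A_nth_Suc: "(1 - q ^ Suc n) * fps_nth A (Suc n) = - (q ^ Suc n) * fps_nth B n"
proof -
  have "1 - q ^ Suc n \<noteq> 0" "1 - b * q ^ n \<noteq> 0"
    using exp_power_neq_1[of "Suc n"] b_power_neq_1[of n] by auto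
  moreover have "fps_nth B n = hahn_exton_coeff \<nu> t n / (1 - b * q ^ n)"
    using B_nth[of n] \<open>1 - b * q ^ n \<noteq> 0\<close> by (simp add: phi_def field_simps)
  ultimately show ?thesis
    by (simp add: phi_def hahn_exton_coeff_Suc del: power_Suc)
qed

lemma B_q_difference: "B = A + fps_const b * (B oo (fps_const q * fps_X))"
  by (simp add: fps_eq_iff flip: B_nth) (simp add: algebra_simps)

lemma A_q_difference: "A = A_shift + fps_X * B"
proof (rule fps_ext)
  fix n
  show "fps_nth A n = fps_nth (A_shift + fps_X * B) n"
  proof (cases n)
    case (Suc m)
    \<comment> \<open>The factor q^n clears the inverse powers of q in \<open>A_shift\<close> and is
      cancelled at the end.\<close>
    have "q ^ n * fps_nth A n = fps_nth A n + q ^ n * fps_nth B m"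
      using A_nth_Suc[of m] Suc by (simp add: algebra_simps)
    moreover have "q ^ n * fps_nth A_shift n = fps_nth A n"
      by (simp add: A_shift_def) (simp add: power_inverse field_simps)
    ultimately have "q ^ n * fps_nth A n = q ^ n * (fps_nth A_shift n + fps_nth B m)"
      by (simp add: distrib_left)
    then show ?thesis using Suc by (simp del: power_Suc)
  qed simp
qed

lemma rho_mult_A_shift: "rho * A_shift = B"
  by (simp add: rho_def fps_divide_unit mult.assoc inverse_mult_eq_1)

lemma phi_ratio_mult_A: "phi_ratio \<nu> t * A = B"
  by (simp add: phi_ratio_def B_def fps_divide_unit mult.assoc inverse_mult_eq_1)

lemma A_nonzero: "A \<noteq> 0" "A_shift \<noteq> 0"
  by (metis fps_zero_nth phi_nth_0 zero_neq_one) (metis fps_zero_nth A_shift_nth_0 zero_neq_one)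

text \<open>Substituting qx for x in \<open>rho * A_shift = B\<close> turns the denominator into
  \<open>A\<close>; the first q-difference equation divided by \<open>A\<close> is then the
  claim.\<close>

lemma phi_ratio_eq_rho: "phi_ratio \<nu> t = 1 + fps_const b * (rho oo (fps_const q * fps_X))"
proof -
  have "A_shift oo (fps_const q * fps_X) = A"
    by (simp add: fps_eq_iff A_shift_def power_inverse)
  then have "(rho oo (fps_const q * fps_X)) * A = B oo (fps_const q * fps_X)"
    using fps_compose_mult_distrib[of "fps_const q * fps_X" rho A_shift] rho_mult_A_shift by simp
  moreover have "(1 + fps_const b * (rho oo (fps_const q * fps_X))) * A =
      A + fps_const b * ((rho oo (fps_const q * fps_X)) * A)"
    by (simp add: algebra_simps)
  ultimately have "(1 + fps_const b * (rho oo (fps_const q * fps_X))) * A = phi_ratio \<nu> t * A"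
    using B_q_difference by (simp only: phi_ratio_mult_A)
  then show ?thesis using A_nonzero by simp
qed

text \<open>Multiply by \<open>A * A_shift\<close> and expand one \<open>A\<close> by the second
  q-difference equation; \<open>B\<close> is rewritten as \<open>phi_ratio \<nu> t * A\<close> or as
  \<open>rho * A_shift\<close>, whichever exposes the common factor.\<close>

lemma rho_eq: "rho = phi_ratio \<nu> t * (1 + fps_X * rho)"
proof -
  have "rho * (A * A_shift) = B * A"
    using rho_mult_A_shift by (simp add: mult_ac)
  also have "\<dots> = B * (A_shift + fps_X * B)"
    using A_q_difference by simp
  also have "\<dots> = phi_ratio \<nu> t * A * A_shift + fps_X * (phi_ratio \<nu> t * A) * (rho * A_shift)"
    by (simp only: phi_ratio_mult_A rho_mult_A_shift) (simp add: algebra_simps)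
  also have "\<dots> = phi_ratio \<nu> t * (1 + fps_X * rho) * (A * A_shift)"
    by (simp add: algebra_simps)
  finally show ?thesis using A_nonzero by simp
qed

text \<open>At bx the series \<open>A_shift\<close> has argument bx/q = q^\<nu> x, so it becomes the
  denominator for base 1/q. The sign and the outer factor b come from 1/(1 - 1/b) = -b/(1 -
  b).\<close>

lemma phi_ratio_minus: "phi_ratio \<nu> (- t) = - (fps_const b * (rho oo (fps_const b * fps_X)))"
proof -
  have A': "A_shift oo (fps_const b * fps_X) = phi \<nu> (- t)"
    by (simp add: fps_eq_iff A_shift_def phi_minus bpow_add power_mult_distrib power_inverse)
  have c: "1 / (1 - inverse b) = - b / (1 - b)"
    using b_neq_1 by (simp add: field_simps)
  have B': "fps_const (1 / (1 - bpow (- t) (\<nu> + 1))) * phi (\<nu> + 1) (- t)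
      = - (fps_const b * (B oo (fps_const b * fps_X)))"
    unfolding bpow_minus c by (simp add: fps_eq_iff B_def phi_minus)
  have "(rho oo (fps_const b * fps_X)) * phi \<nu> (- t) = B oo (fps_const b * fps_X)"
    using fps_compose_mult_distrib[of "fps_const b * fps_X" rho A_shift] rho_mult_A_shift A' by simp
  then have "phi_ratio \<nu> (- t) = - (fps_const b * (rho oo (fps_const b * fps_X))) * phi \<nu> (- t) / phi \<nu> (- t)"
    unfolding phi_ratio_def B' by (simp add: mult.assoc)
  also have "\<dots> = - (fps_const b * (rho oo (fps_const b * fps_X)))"
    by (rule fps_divide_times_eq) (metis fps_zero_nth phi_nth_0 zero_neq_one)
  finally show ?thesis .
qed

lemma rho_nth_0: "(1 - b) * fps_nth rho 0 = 1"
  using b_neq_1 by (simp add: rho_def B_def)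

lemma phi_ratio_nth:
  "fps_nth (phi_ratio \<nu> t) n = (if n = 0 then 1 else 0) + b * q ^ n * fps_nth rho n"
  by (simp add: phi_ratio_eq_rho)

text \<open>Compare coefficients in rho = r + x r rho, where r is the ratio for base q; the part b
  q^n rho_n of r_n moves to the left, and only indices below n remain on the right.\<close>

lemma rho_nth_rec:
  assumes "n \<ge> 1"
  shows "(1 - b * q ^ n) * fps_nth rho n =
    (\<Sum>j<n. (if j = 0 then 1 else b * q ^ j) * fps_nth rho j * fps_nth rho (n - 1 - j))"
proof -
  obtain m where m: "n = Suc m" using assms by (cases n) auto
  \<comment> \<open>At j = 0, (1 - b) rho_0 = 1 gives r_0 = 1 + b rho_0 = rho_0, whence the weight
    1.\<close>
  have e: "(if j = 0 then 1 else b * q ^ j) * fps_nth rho j = fps_nth (phi_ratio \<nu> t) j" for j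
    using rho_nth_0 by (auto simp: phi_ratio_nth algebra_simps)
  have "fps_nth rho n = fps_nth (phi_ratio \<nu> t + fps_X * (phi_ratio \<nu> t * rho)) n"
    using rho_eq by (simp add: algebra_simps)
  also have "\<dots> = b * q ^ n * fps_nth rho n
      + (\<Sum>j=0..m. fps_nth (phi_ratio \<nu> t) j * fps_nth rho (m - j))"
    by (simp add: phi_ratio_nth[of "Suc m"] m) (simp add: fps_mult_nth)
  also have "{0..m} = {..<n}" using m by auto
  finally show ?thesis
    unfolding e using m by (simp add: algebra_simps)
qed

end

section \<open>Functions of the base given by nonnegative integer polynomials\<close>

text \<open>\<open>P\<close> is chosen before \<open>t\<close>, so that a single polynomial serves
  all bases.\<close>

definition nonneg_poly :: "complex \<Rightarrow> (complex \<Rightarrow> complex) \<Rightarrow> bool" where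
  "nonneg_poly \<nu> f \<longleftrightarrow>
     (\<exists>P. \<forall>t. generic_base \<nu> t \<longrightarrow> f t = eval3 P (exp t) (bpow t \<nu>) (qnum t \<nu>))"

lemma eval3_add: "eval3 (P + Q) x y u = eval3 P x y u + eval3 Q x y u"
proof -
  let ?f = "\<lambda>k c. of_nat c * (case k of (i, j, l) \<Rightarrow> x ^ i * y ^ j * u ^ l)"
  have e: "eval3 R x y u = (\<Sum>k\<in>Poly_Mapping.keys R. ?f k (Poly_Mapping.lookup R k))" for R
    unfolding eval3_def by (intro sum.cong) (auto simp: mult.assoc)
  show ?thesis
    unfolding e by (rule setsum_keys_plus_distrib) (simp_all add: algebra_simps)
qed

lemma eval3_single: "eval3 (Poly_Mapping.single (i, j, k) c) x y u = of_nat c * x ^ i * y ^ j * u ^ k"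
  by (simp add: eval3_def)

lemma nonneg_poly_monomial:
  "nonneg_poly \<nu> (\<lambda>t. of_nat c * exp t ^ i * bpow t \<nu> ^ j * qnum t \<nu> ^ k)"
  unfolding nonneg_poly_def by (rule exI[of _ "Poly_Mapping.single (i, j, k) c"]) (simp add: eval3_single)

lemma nonneg_poly_of_nat: "nonneg_poly \<nu> (\<lambda>_. of_nat c)"
  using nonneg_poly_monomial[of \<nu> c 0 0 0] by simp

lemma nonneg_poly_1: "nonneg_poly \<nu> (\<lambda>_. 1)"
  using nonneg_poly_of_nat[of \<nu> 1] by simp

lemma nonneg_poly_exp: "nonneg_poly \<nu> exp"
  using nonneg_poly_monomial[of \<nu> 1 1 0 0] by simp

lemma nonneg_poly_bpow: "nonneg_poly \<nu> (\<lambda>t. bpow t \<nu>)"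
  using nonneg_poly_monomial[of \<nu> 1 0 1 0] by simp

lemma nonneg_poly_qnum: "nonneg_poly \<nu> (\<lambda>t. qnum t \<nu>)"
  using nonneg_poly_monomial[of \<nu> 1 0 0 1] by simp

lemma nonneg_poly_cong:
  assumes "nonneg_poly \<nu> f" and "\<And>t. generic_base \<nu> t \<Longrightarrow> f t = g t"
  shows "nonneg_poly \<nu> g"
  using assms unfolding nonneg_poly_def by metis

lemma nonneg_poly_add:
  assumes "nonneg_poly \<nu> f" "nonneg_poly \<nu> g"
  shows "nonneg_poly \<nu> (\<lambda>t. f t + g t)"
  using assms unfolding nonneg_poly_def by (metis eval3_add)

lemma nonneg_poly_sum:
  assumes "\<And>i. i \<in> I \<Longrightarrow> nonneg_poly \<nu> (f i)"
  shows "nonneg_poly \<nu> (\<lambda>t. \<Sum>i\<in>I. f i t)"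
  using assms
proof (induction I rule: infinite_finite_induct)
  case (insert i I)
  then show ?case by (simp add: nonneg_poly_add)
qed (use nonneg_poly_of_nat[of \<nu> 0] in simp_all)

text \<open>Expanding both evaluations into monomials reduces the claim to closure under finite
  sums.\<close>

lemma nonneg_poly_mult:
  assumes "nonneg_poly \<nu> f" "nonneg_poly \<nu> g"
  shows "nonneg_poly \<nu> (\<lambda>t. f t * g t)"
proof -
  obtain P Q where
    P: "\<And>t. generic_base \<nu> t \<Longrightarrow> f t = eval3 P (exp t) (bpow t \<nu>) (qnum t \<nu>)" and
    Q: "\<And>t. generic_base \<nu> t \<Longrightarrow> g t = eval3 Q (exp t) (bpow t \<nu>) (qnum t \<nu>)"
    using assms unfolding nonneg_poly_def by metis
  let ?h = "\<lambda>(i, j, k) (i', j', k') t.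
    of_nat (Poly_Mapping.lookup P (i, j, k) * Poly_Mapping.lookup Q (i', j', k')) *
    exp t ^ (i + i') * bpow t \<nu> ^ (j + j') * qnum t \<nu> ^ (k + k')"
  have "nonneg_poly \<nu> (?h a a')" for a a'
    by (cases a, cases a') (simp only: prod.case nonneg_poly_monomial)
  then have "nonneg_poly \<nu> (\<lambda>t. \<Sum>a\<in>Poly_Mapping.keys P. \<Sum>a'\<in>Poly_Mapping.keys Q. ?h a a' t)"
    by (intro nonneg_poly_sum)
  moreover have "(\<Sum>a\<in>Poly_Mapping.keys P. \<Sum>a'\<in>Poly_Mapping.keys Q. ?h a a' t) = f t * g t"
    if "generic_base \<nu> t" for t
    unfolding P[OF that] Q[OF that] eval3_def sum_product
    by (intro sum.cong refl) (auto simp: power_add mult_ac)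
  ultimately show ?thesis by (rule nonneg_poly_cong)
qed

lemma nonneg_poly_power: "nonneg_poly \<nu> f \<Longrightarrow> nonneg_poly \<nu> (\<lambda>t. f t ^ n)"
  by (induction n) (simp_all add: nonneg_poly_1 nonneg_poly_mult)

lemma nonneg_poly_prod:
  assumes "\<And>i. i \<in> I \<Longrightarrow> nonneg_poly \<nu> (f i)"
  shows "nonneg_poly \<nu> (\<lambda>t. \<Prod>i\<in>I. f i t)"
  using assms
proof (induction I rule: infinite_finite_induct)
  case (insert i I)
  then show ?case by (simp add: nonneg_poly_mult)
qed (simp_all add: nonneg_poly_1)

text \<open>Uses [k+\<nu>] = [\<nu>] + q^\<nu> (1 + ... + q^(k-1)); this is where [\<nu>] enters as
  a third variable.\<close>

lemma nonneg_poly_qnum_shift: "nonneg_poly \<nu> (\<lambda>t. qnum t (of_nat k + \<nu>))"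
proof (rule nonneg_poly_cong)
  show "nonneg_poly \<nu> (\<lambda>t. qnum t \<nu> + bpow t \<nu> * (\<Sum>i<k. exp t ^ i))"
    by (intro nonneg_poly_add nonneg_poly_mult nonneg_poly_sum nonneg_poly_power
        nonneg_poly_qnum nonneg_poly_bpow nonneg_poly_exp)
next
  fix t assume "generic_base \<nu> t"
  then have "exp t \<noteq> 1" using generic_base.exp_power_neq_1[of \<nu> t 1] by simp
  moreover have "bpow t (of_nat k + \<nu>) = bpow t \<nu> * exp t ^ k"
    using bpow_add_of_nat[of t \<nu> k] by (simp add: add.commute)
  ultimately show "qnum t \<nu> + bpow t \<nu> * (\<Sum>i<k. exp t ^ i) = qnum t (of_nat k + \<nu>)"
    by (simp add: qnum_def sum_gp_strict field_simps)
qed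

section \<open>Normalised coefficients and the denominators D_n\<close>

text \<open>This will be N_n / D_n. Index n belongs to z^(2n-1), hence to the coefficient n - 1 of
  \<open>rho\<close>, and w = (1 - q) z supplies the power of 1 - q. The value at n = 0 is never
  read by \<open>odd_fps\<close>.\<close>

definition ratio_coeff :: "complex \<Rightarrow> nat \<Rightarrow> complex \<Rightarrow> complex" where
  "ratio_coeff \<nu> n t = (1 - exp t) ^ (2 * n - 1) * fps_nth (generic_base.rho \<nu> t) (n - 1)"

text \<open>Factors with m > k have exponent \<open>k div m = 0\<close>, so different D_k can be
  written over one index range.\<close>

lemma Dprod_extend:
  assumes "k \<le> n"
  shows "Dprod k \<nu> t = (\<Prod>m=1..n. qnum t (of_nat m + \<nu>) ^ (k div m))"
  unfolding Dprod_def by (rule prod.mono_neutral_left) (use assms in auto)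

lemma div_add_div_le:
  fixes k n m :: nat
  assumes "k \<le> n"
  shows "k div m + (n - k) div m \<le> n div m"
  using div_add1_eq[of k "n - k" m] assms by simp

text \<open>The factor m = n occurs once and is taken out. For m < n superadditivity of the floor
  makes the subtraction of exponents exact, so the cofactor is again a product of powers of
  [m+\<nu>].\<close>

lemma Dprod_split:
  assumes k: "1 \<le> k" "k < n"
  shows "Dprod n \<nu> t = qnum t (of_nat n + \<nu>) * Dprod k \<nu> t * Dprod (n - k) \<nu> t *
    (\<Prod>m=1..n - 1. qnum t (of_nat m + \<nu>) ^ (n div m - (k div m + (n - k) div m)))"
proof -
  let ?c = "\<lambda>m. qnum t (of_nat m + \<nu>)"
  obtain n' where n: "n = Suc n'" using k by (cases n) auto
  have "Dprod n \<nu> t = ?c n * (\<Prod>m=1..n - 1. ?c m ^ (n div m))"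
    unfolding Dprod_def n by (simp add: mult.commute)
  also have "(\<Prod>m=1..n - 1. ?c m ^ (n div m)) = (\<Prod>m=1..n - 1. ?c m ^ (k div m) * ?c m ^ ((n - k) div m) *
      ?c m ^ (n div m - (k div m + (n - k) div m)))"
    using div_add_div_le[of k n] k by (intro prod.cong refl) (simp flip: power_add)
  also have "\<dots> = Dprod k \<nu> t * Dprod (n - k) \<nu> t *
      (\<Prod>m=1..n - 1. ?c m ^ (n div m - (k div m + (n - k) div m)))"
    using k by (simp add: Dprod_extend[of k "n - 1"] Dprod_extend[of "n - k" "n - 1"] prod.distrib)
  finally show ?thesis by (simp add: mult.assoc)
qed

context generic_base
begin

lemma qnum_shift: "(1 - q) * qnum t (of_nat (Suc n) + \<nu>) = 1 - b * q ^ n"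
proof -
  have "bpow t (of_nat (Suc n) + \<nu>) = b * q ^ n"
    using bpow_add_of_nat[of t "\<nu> + 1" n] by (simp add: add_ac)
  then show ?thesis using exp_power_neq_1[of 1] by (simp add: qnum_def)
qed

lemma ratio_coeff_1: "qnum t (1 + \<nu>) * ratio_coeff \<nu> 1 t = 1"
  using rho_nth_0 by (simp add: ratio_coeff_def mult_ac flip: qnum_shift[of 0, simplified])

text \<open>The factor [n+\<nu>] absorbs one of the 2n-1 powers of 1 - q; the other 2n-2 split as
  (2k-1) + (2(n-k)-1). With k = j+1 the weight b q^j is q^\<nu> q^k.\<close>

lemma ratio_coeff_rec:
  assumes "n \<ge> 2"
  shows "qnum t (of_nat n + \<nu>) * ratio_coeff \<nu> n t =
    (\<Sum>k=1..n - 1. (if k = 1 then 1 else bpow t \<nu> * q ^ k) *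
       ratio_coeff \<nu> k t * ratio_coeff \<nu> (n - k) t)"
proof -
  obtain m where n: "n = Suc m" and m: "m \<ge> 1" using assms by (cases n) auto
  have "qnum t (of_nat n + \<nu>) * ratio_coeff \<nu> n t =
      (1 - q) ^ (2 * m) * ((1 - b * q ^ m) * fps_nth rho m)"
    unfolding qnum_shift[symmetric] by (simp add: n ratio_coeff_def del: of_nat_Suc)
  also have "\<dots> = (\<Sum>j<m. (1 - q) ^ (2 * m) *
      ((if j = 0 then 1 else b * q ^ j) * fps_nth rho j * fps_nth rho (m - 1 - j)))"
    unfolding rho_nth_rec[OF m] sum_distrib_left ..
  also have "\<dots> = (\<Sum>j<m. (if Suc j = 1 then 1 else bpow t \<nu> * q ^ Suc j) *
       ratio_coeff \<nu> (Suc j) t * ratio_coeff \<nu> (n - Suc j) t)"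
  proof (rule sum.cong)
    fix j assume "j \<in> {..<m}"
    then have "2 * m = (2 * Suc j - 1) + (2 * (n - Suc j) - 1)" using n by auto
    then have *: "(1 - q) ^ (2 * m) = (1 - q) ^ (2 * Suc j - 1) * (1 - q) ^ (2 * (n - Suc j) - 1)"
      by (simp only: power_add)
    show "(1 - q) ^ (2 * m) *
      ((if j = 0 then 1 else b * q ^ j) * fps_nth rho j * fps_nth rho (m - 1 - j)) =
      (if Suc j = 1 then 1 else bpow t \<nu> * q ^ Suc j) *
       ratio_coeff \<nu> (Suc j) t * ratio_coeff \<nu> (n - Suc j) t"
      unfolding * ratio_coeff_def by (simp add: n bpow_add mult_ac)
  qed simp
  also have "\<dots> = (\<Sum>k=1..n - 1. (if k = 1 then 1 else bpow t \<nu> * q ^ k) *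
       ratio_coeff \<nu> k t * ratio_coeff \<nu> (n - k) t)"
    by (rule sum.reindex_bij_witness[of _ "\<lambda>k. k - 1" Suc]) (auto simp: n)
  finally show ?thesis .
qed

lemma Dprod_nonzero: "Dprod n \<nu> t \<noteq> 0"
proof -
  have "qnum t (of_nat k + \<nu>) \<noteq> 0" if "k \<ge> 1" for k
    using bpow_shift_neq_1[OF that] exp_power_neq_1[of 1] by (simp add: qnum_def add.commute)
  then show ?thesis by (simp add: Dprod_def)
qed

end

section \<open>Nonnegativity of the numerators\<close>

text \<open>Strong induction: multiply the recurrence by D_n = [n+\<nu>] D_k D_(n-k) C_k and cancel
  [n+\<nu>]. Each summand is then a product of two earlier numerators with nonnegative
  polynomials.\<close>

lemma nonneg_poly_numerator:
  assumes "n \<ge> 1"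
  shows "nonneg_poly \<nu> (\<lambda>t. ratio_coeff \<nu> n t * Dprod n \<nu> t)"
  using assms
proof (induction n rule: less_induct)
  case (less n)
  show ?case
  proof (cases "n = 1")
    case True
    have "1 = ratio_coeff \<nu> n t * Dprod n \<nu> t" if "generic_base \<nu> t" for t
      using generic_base.ratio_coeff_1[OF that] True by (simp add: Dprod_def mult.commute)
    then show ?thesis by (rule nonneg_poly_cong[OF nonneg_poly_1])
  next
    case False
    define C where "C = (\<lambda>k t. \<Prod>m=1..n - 1. qnum t (of_nat m + \<nu>) ^ (n div m - (k div m + (n - k) div m)))"
    let ?e = "\<lambda>k t. if k = 1 then 1 else bpow t \<nu> * exp t ^ k"
    let ?f = "\<lambda>t. \<Sum>k=1..n - 1. ?e k t * (ratio_coeff \<nu> k t * Dprod k \<nu> t) *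
      (ratio_coeff \<nu> (n - k) t * Dprod (n - k) \<nu> t) * C k t"
    have e: "nonneg_poly \<nu> (?e k)" for k
      by (cases "k = 1") (simp_all add: nonneg_poly_1 nonneg_poly_mult nonneg_poly_bpow
          nonneg_poly_power nonneg_poly_exp)
    have "nonneg_poly \<nu> ?f"
      unfolding C_def
      by (intro nonneg_poly_sum nonneg_poly_mult nonneg_poly_prod nonneg_poly_power
          nonneg_poly_qnum_shift e less.IH) auto
    moreover have "?f t = ratio_coeff \<nu> n t * Dprod n \<nu> t" if "generic_base \<nu> t" for t
    proof -
      define c where "c = qnum t (of_nat n + \<nu>)"
      \<comment> \<open>\<open>c\<close> is the factor of \<open>Dprod n \<nu> t\<close> at index n,
        where the exponent is \<open>n div n = 1\<close>.\<close>
      have "c \<noteq> 0"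
        using generic_base.Dprod_nonzero[OF that, of n] \<open>n \<ge> 1\<close> by (auto simp: Dprod_def c_def)
      have "n \<ge> 2" using False \<open>n \<ge> 1\<close> by simp
      note rec = generic_base.ratio_coeff_rec[OF that this, folded c_def]
      have "c * (ratio_coeff \<nu> n t * Dprod n \<nu> t) =
          (\<Sum>k=1..n - 1. ?e k t * ratio_coeff \<nu> k t * ratio_coeff \<nu> (n - k) t) * Dprod n \<nu> t"
        unfolding rec[symmetric] by simp
      also have "\<dots> = (\<Sum>k=1..n - 1. c * (?e k t * (ratio_coeff \<nu> k t * Dprod k \<nu> t) *
          (ratio_coeff \<nu> (n - k) t * Dprod (n - k) \<nu> t) * C k t))"
        unfolding sum_distrib_right
      proof (rule sum.cong)
        fix k assume "k \<in> {1..n - 1}"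
        then have "Dprod n \<nu> t = c * Dprod k \<nu> t * Dprod (n - k) \<nu> t * C k t"
          unfolding C_def c_def by (intro Dprod_split) auto
        then show "?e k t * ratio_coeff \<nu> k t * ratio_coeff \<nu> (n - k) t * Dprod n \<nu> t =
          c * (?e k t * (ratio_coeff \<nu> k t * Dprod k \<nu> t) *
          (ratio_coeff \<nu> (n - k) t * Dprod (n - k) \<nu> t) * C k t)"
          by (simp only: mult_ac)
      qed simp
      also have "\<dots> = c * ?f t"
        by (simp only: sum_distrib_left)
      finally show ?thesis using \<open>c \<noteq> 0\<close> by simp
    qed
    ultimately show ?thesis by (rule nonneg_poly_cong)
  qed
qed

section \<open>The expansions for both bases\<close>

context generic_base
begin

text \<open>In -b rho(bx) the coefficient n - 1 carries b b^(n-1) = b^n = q^((\<nu>+1)n).\<close>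

lemma hahn_exton_ratio_inverse_base:
  "hahn_exton_ratio \<nu> (- t) oo (fps_const (1 - q) * fps_X) =
    - odd_fps (\<lambda>n. ratio_coeff \<nu> n t * bpow t ((\<nu> + 1) * of_nat n))"
proof (rule fps_ext)
  fix m
  have *: "bpow t ((\<nu> + 1) * of_nat n) = b ^ n" for n
    by (simp add: bpow_def exp_of_nat_mult [symmetric] mult_ac)
  show "fps_nth (hahn_exton_ratio \<nu> (- t) oo (fps_const (1 - q) * fps_X)) m =
    fps_nth (- odd_fps (\<lambda>n. ratio_coeff \<nu> n t * bpow t ((\<nu> + 1) * of_nat n))) m"
    unfolding * hahn_exton_ratio_nth
    by (auto simp: odd_fps_def phi_ratio_minus ratio_coeff_def elim!: oddE)
qed

text \<open>The constant 1 in r = 1 + b rho(qx) gives the separate term (1 - q) z; the other terms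
  carry b q^(n-1) = q^(n+\<nu>).\<close>

lemma hahn_exton_ratio_base:
  "hahn_exton_ratio \<nu> t oo (fps_const (1 - q) * fps_X) =
    fps_const (1 - q) * fps_X + odd_fps (\<lambda>n. ratio_coeff \<nu> n t * bpow t (of_nat n + \<nu>))"
proof (rule fps_ext)
  fix m
  have *: "bpow t (of_nat (Suc n) + \<nu>) = b * q ^ n" for n
    using bpow_add_of_nat[of t "\<nu> + 1" n] by (simp add: add_ac)
  show "fps_nth (hahn_exton_ratio \<nu> t oo (fps_const (1 - q) * fps_X)) m =
    fps_nth (fps_const (1 - q) * fps_X +
      odd_fps (\<lambda>n. ratio_coeff \<nu> n t * bpow t (of_nat n + \<nu>))) m"
    unfolding hahn_exton_ratio_nth
    by (auto simp: odd_fps_def phi_ratio_nth ratio_coeff_def * distrib_left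
        simp del: of_nat_Suc elim!: oddE)
qed

end

theorem theorem2p6:
  fixes \<nu> :: complex
  assumes "\<forall>k::nat. k \<ge> 1 \<longrightarrow> \<nu> \<noteq> - of_nat k"
  shows "\<exists>N :: nat \<Rightarrow> (nat \<times> nat \<times> nat \<Rightarrow>\<^sub>0 nat).
    \<forall>t q :: complex.
      q = exp t \<and> (\<forall>k::nat. k \<ge> 1 \<longrightarrow> q ^ k \<noteq> 1) \<and>
      (\<forall>k::nat. k \<ge> 1 \<longrightarrow> bpow t (\<nu> + of_nat k) \<noteq> 1) \<longrightarrow>
      hahn_exton_ratio \<nu> (- t) oo (fps_const (1 - q) * fps_X) =
        - odd_fps (\<lambda>n. eval3 (N n) q (bpow t \<nu>) (qnum t \<nu>) / Dprod n \<nu> t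
                         * bpow t ((\<nu> + 1) * of_nat n)) \<and>
      hahn_exton_ratio \<nu> t oo (fps_const (1 - q) * fps_X) =
        fps_const (1 - q) * fps_X +
        odd_fps (\<lambda>n. eval3 (N n) q (bpow t \<nu>) (qnum t \<nu>) / Dprod n \<nu> t
                       * bpow t (of_nat n + \<nu>))"
proof -
  \<comment> \<open>The guard on n stands inside the existential so that choice yields a total
    \<open>N\<close>, with \<open>N 0\<close> arbitrary.\<close>
  have "\<exists>P. \<forall>t. generic_base \<nu> t \<longrightarrow>
      n \<ge> 1 \<longrightarrow> ratio_coeff \<nu> n t = eval3 P (exp t) (bpow t \<nu>) (qnum t \<nu>) / Dprod n \<nu> t" for n
    using nonneg_poly_numerator[of n \<nu>] generic_base.Dprod_nonzero[of \<nu> _ n]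
    unfolding nonneg_poly_def by (metis nonzero_eq_divide_eq)
  then obtain N where N: "\<And>n t. generic_base \<nu> t \<Longrightarrow> n \<ge> 1 \<Longrightarrow>
      eval3 (N n) (exp t) (bpow t \<nu>) (qnum t \<nu>) / Dprod n \<nu> t = ratio_coeff \<nu> n t"
    by metis
  have odd_fps_cong: "odd_fps c = odd_fps d" if "\<And>n. n \<ge> 1 \<Longrightarrow> c n = d n" for c d
    using that by (auto simp: odd_fps_def fps_eq_iff elim!: oddE)
  show ?thesis
  proof (rule exI[of _ N], intro allI impI, elim conjE)
    fix t q :: complex
    assume q: "q = exp t" "\<forall>k::nat. k \<ge> 1 \<longrightarrow> q ^ k \<noteq> 1"
      and "\<forall>k::nat. k \<ge> 1 \<longrightarrow> bpow t (\<nu> + of_nat k) \<noteq> 1"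
    then have g: "generic_base \<nu> t" by unfold_locales auto
    show "hahn_exton_ratio \<nu> (- t) oo (fps_const (1 - q) * fps_X) =
        - odd_fps (\<lambda>n. eval3 (N n) q (bpow t \<nu>) (qnum t \<nu>) / Dprod n \<nu> t
                         * bpow t ((\<nu> + 1) * of_nat n)) \<and>
      hahn_exton_ratio \<nu> t oo (fps_const (1 - q) * fps_X) =
        fps_const (1 - q) * fps_X +
        odd_fps (\<lambda>n. eval3 (N n) q (bpow t \<nu>) (qnum t \<nu>) / Dprod n \<nu> t
                       * bpow t (of_nat n + \<nu>))"
      unfolding q(1) generic_base.hahn_exton_ratio_inverse_base[OF g]
        generic_base.hahn_exton_ratio_base[OF g]
      by (intro conjI arg_cong2[of _ _ _ _ "(+)"] arg_cong[of _ _ uminus] odd_fps_cong)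
        (simp_all add: N[OF g])
  qed
qed

end
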